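(* Let $A \in M_n(\mathbb{C})$ be a nonzero positive contraction, let $0 \leq \delta \leq 1$, and put $$c = \delta\, \frac{\operatorname{tr}(A)^2}{\operatorname{tr}(A^2)}.$$ If $cn$ is a positive integer, then there is a principal submatrix $A_S$ of $A$ of size $cn$ such that $$\lambda_{\min}(A_S) \geq \operatorname{tr}(A)\left[\sqrt{1-c}-\sqrt{\delta-c}\right]^2.$$
   Context: A positive contraction is a hermitian matrix $A$ with $0\le A\le I$. $\operatorname{tr}=\frac1n\operatorname{Tr}$ is the normalized trace on $M_n(\mathbb{C})$ and $\lambda_{\min}$ is the smallest eigenvalue. $A_S$, for $S\subset\{1,\dots,n\}$, is the principal submatrix with rows and columns indexed by $S$. (Note that $0\le c\le\delta$.) *)

theory Defs
  imports
    "Jordan_Normal_Form.Schur_Decomposition"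
    "Jordan_Normal_Form.Spectral_Radius"
    "Jordan_Normal_Form.DL_Submatrix"
begin

definition hermitian_mat :: "complex mat \<Rightarrow> bool" where
  "hermitian_mat A \<longleftrightarrow> mat_adjoint A = A"

(* The quadratic form v\<^sup>* A v of a hermitian matrix is real, so taking Re loses nothing. *)
definition psd_mat :: "complex mat \<Rightarrow> bool" where
  "psd_mat A \<longleftrightarrow> hermitian_mat A \<and> (\<forall>v \<in> carrier_vec (dim_row A). 0 \<le> Re ((A *\<^sub>v v) \<bullet>c v))"

definition loewner_le :: "complex mat \<Rightarrow> complex mat \<Rightarrow> bool" where
  "loewner_le A B \<longleftrightarrow> psd_mat (B - A)"

definition positive_contraction :: "complex mat \<Rightarrow> bool" where
  "positive_contraction A \<longleftrightarrow> hermitian_mat A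
     \<and> loewner_le (0\<^sub>m (dim_row A) (dim_row A)) A \<and> loewner_le A (1\<^sub>m (dim_row A))"

(* Normalized trace, (1/n) Tr. *)
definition ntr :: "complex mat \<Rightarrow> complex" where
  "ntr A = (\<Sum>i<dim_row A. A $$ (i, i)) / of_nat (dim_row A)"

(* Meant for hermitian matrices of positive size: all their eigenvalues are real and there is
   at least one, so the Min is over a finite nonempty set. *)
definition lambda_min :: "complex mat \<Rightarrow> real" where
  "lambda_min A = Min {x. eigenvalue A (complex_of_real x)}"

(* Rows and columns are indexed from 0, so index sets are subsets of {0..<n}. *)
abbreviation principal_submatrix :: "complex mat \<Rightarrow> nat set \<Rightarrow> complex mat" where
  "principal_submatrix A S \<equiv> submatrix A S S"

end

theory Submission
  imports Defs
begin

text \<open>The submatrix is found greedily, with the resolvent trace as barrier. Suppose \<open>B > x\<close> is a principal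
  submatrix, \<open>M = (B - x)\<^sup>-\<^sup>1\<close> and \<open>e tr M < 1\<close>. Then \<open>B > x + e\<close>, and with \<open>F = (B - x - e)\<^sup>-\<^sup>1\<close> some
  index \<open>i\<close> satisfies \<open>tr F - (F\<^sup>2)\<^sub>i\<^sub>i / F\<^sub>i\<^sub>i \<le> tr M\<close>. The left-hand side is the resolvent trace at
  \<open>x + e\<close> after deleting \<open>i\<close>, so the barrier moves up by \<open>e\<close> with each deletion. Starting from
  \<open>x = -s\<close>, Cauchy-Schwarz gives \<open>s tr (A + s)\<^sup>-\<^sup>1 \<le> n - (tr A)\<^sup>2 / tr (A\<^sup>2 + s A)\<close> with unnormalized
  traces; optimizing over \<open>s\<close> after \<open>n - cn\<close> deletions yields the bound up to an
  arbitrarily small loss, which is removed because there are only finitely many index sets.\<close>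

section \<open>Matrix algebra over a finite index set\<close>

type_synonym kernel = "nat \<Rightarrow> nat \<Rightarrow> complex"

text \<open>A principal submatrix is encoded as a function on all of \<open>nat \<times> nat\<close> together with its index
  set \<open>S\<close>, so that deleting an index requires no renumbering of rows and columns.\<close>

definition fmult :: "nat set \<Rightarrow> kernel \<Rightarrow> kernel \<Rightarrow> kernel" where
  "fmult S A B = (\<lambda>i j. \<Sum>k\<in>S. A i k * B k j)"

definition add_scaled :: "real \<Rightarrow> kernel \<Rightarrow> kernel \<Rightarrow> kernel" where
  "add_scaled t A B = (\<lambda>i j. A i j + of_real t * B i j)"

text \<open>Because of the truncation this is a two-sided unit for \<open>fmult S\<close> exactly on
  the kernels supported on \<open>S\<close>, so support has to be tracked in every computation with
  inverses.\<close>

definition fident :: "nat set \<Rightarrow> kernel" where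
  "fident S = (\<lambda>i j. if i = j \<and> i \<in> S then 1 else 0)"

definition ftrace :: "nat set \<Rightarrow> kernel \<Rightarrow> real" where
  "ftrace S A = Re (\<Sum>i\<in>S. A i i)"

definition fhermitian :: "kernel \<Rightarrow> bool" where
  "fhermitian A \<longleftrightarrow> (\<forall>i j. cnj (A i j) = A j i)"

definition supported :: "nat set \<Rightarrow> kernel \<Rightarrow> bool" where
  "supported S A \<longleftrightarrow> (\<forall>i j. i \<notin> S \<or> j \<notin> S \<longrightarrow> A i j = 0)"

definition fapply :: "nat set \<Rightarrow> kernel \<Rightarrow> (nat \<Rightarrow> complex) \<Rightarrow> nat \<Rightarrow> complex" where
  "fapply S A v = (\<lambda>i. \<Sum>j\<in>S. A i j * v j)"

definition inner_on :: "nat set \<Rightarrow> (nat \<Rightarrow> complex) \<Rightarrow> (nat \<Rightarrow> complex) \<Rightarrow> complex" where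
  "inner_on S u v = (\<Sum>i\<in>S. cnj (u i) * v i)"

definition quad_form :: "nat set \<Rightarrow> kernel \<Rightarrow> (nat \<Rightarrow> complex) \<Rightarrow> real" where
  "quad_form S A v = Re (inner_on S v (fapply S A v))"

definition psd_on :: "nat set \<Rightarrow> kernel \<Rightarrow> bool" where
  "psd_on S A \<longleftrightarrow> (\<forall>v. 0 \<le> quad_form S A v)"

definition pd_on :: "nat set \<Rightarrow> kernel \<Rightarrow> bool" where
  "pd_on S A \<longleftrightarrow> (\<forall>v. (\<exists>i\<in>S. v i \<noteq> 0) \<longrightarrow> 0 < quad_form S A v)"

text \<open>The support clause makes the inverse unique as a kernel, so it can be identified with
  its own adjoint.\<close>

definition inverse_on :: "nat set \<Rightarrow> kernel \<Rightarrow> kernel \<Rightarrow> bool" where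
  "inverse_on S A B \<longleftrightarrow> supported S B \<and> fmult S A B = fident S \<and> fmult S B A = fident S"

lemma fmult_assoc: "fmult S (fmult S A B) C = fmult S A (fmult S B C)"
  unfolding fmult_def sum_distrib_left sum_distrib_right
  by (intro ext, subst sum.swap) (simp add: mult.assoc)

lemma fmult_add_scaled_left: "fmult S (add_scaled t A B) C = add_scaled t (fmult S A C) (fmult S B C)"
  by (simp add: fmult_def add_scaled_def algebra_simps sum.distrib sum_distrib_left fun_eq_iff)

lemma fmult_add_scaled_right: "fmult S A (add_scaled t B C) = add_scaled t (fmult S A B) (fmult S A C)"
  by (simp add: fmult_def add_scaled_def algebra_simps sum.distrib sum_distrib_left fun_eq_iff)

lemma ftrace_add_scaled: "ftrace S (add_scaled t A B) = ftrace S A + t * ftrace S B"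
  by (simp add: ftrace_def add_scaled_def sum.distrib sum_distrib_left)

lemma ftrace_fmult_commute: "ftrace S (fmult S A B) = ftrace S (fmult S B A)"
  unfolding ftrace_def fmult_def by (subst sum.swap) (simp add: mult.commute)

lemma ftrace_fident: "finite S \<Longrightarrow> ftrace S (fident S) = card S"
  by (simp add: ftrace_def fident_def)

lemma fmult_fident_left: "finite S \<Longrightarrow> supported S A \<Longrightarrow> fmult S (fident S) A = A"
proof (intro ext)
  fix i j assume S: "finite S" "supported S A"
  have "fmult S (fident S) A i j = (\<Sum>k\<in>S. if k = i then A i j else 0)"
    unfolding fmult_def fident_def by (intro sum.cong) auto
  then show "fmult S (fident S) A i j = A i j" using S by (auto simp: supported_def)
qed

lemma fmult_fident_right: "finite S \<Longrightarrow> supported S A \<Longrightarrow> fmult S A (fident S) = A"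
proof (intro ext)
  fix i j assume S: "finite S" "supported S A"
  have "fmult S A (fident S) i j = (\<Sum>k\<in>S. if k = j then A i j else 0)"
    unfolding fmult_def fident_def by (intro sum.cong) auto
  then show "fmult S A (fident S) i j = A i j" using S by (auto simp: supported_def)
qed

lemma supported_fident: "supported S (fident S)"
  by (auto simp: supported_def fident_def)

lemma fhermitian_fident: "fhermitian (fident S)"
  by (auto simp: fhermitian_def fident_def)

lemma supported_add_scaled: "supported S A \<Longrightarrow> supported S B \<Longrightarrow> supported S (add_scaled t A B)"
  by (auto simp: supported_def add_scaled_def)

lemma fhermitian_add_scaled: "fhermitian A \<Longrightarrow> fhermitian B \<Longrightarrow> fhermitian (add_scaled t A B)"
  by (auto simp: fhermitian_def add_scaled_def)

lemma fapply_fmult: "fapply S (fmult S A B) v = fapply S A (fapply S B v)"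
  unfolding fmult_def fapply_def sum_distrib_left sum_distrib_right
  by (intro ext, subst sum.swap) (simp add: mult.assoc)

lemma fapply_add_scaled: "fapply S (add_scaled t A B) v = (\<lambda>i. fapply S A v i + of_real t * fapply S B v i)"
  by (simp add: fapply_def add_scaled_def algebra_simps sum.distrib sum_distrib_left fun_eq_iff)

lemma fapply_fident: "finite S \<Longrightarrow> i \<in> S \<Longrightarrow> fapply S (fident S) v i = v i"
proof -
  assume S: "finite S" "i \<in> S"
  have "fapply S (fident S) v i = (\<Sum>k\<in>S. if k = i then v i else 0)"
    unfolding fapply_def fident_def by (intro sum.cong) auto
  then show ?thesis using S by auto
qed

lemma inner_on_cong:
  "(\<And>i. i \<in> S \<Longrightarrow> u i = u' i) \<Longrightarrow> (\<And>i. i \<in> S \<Longrightarrow> v i = v' i) \<Longrightarrow> inner_on S u v = inner_on S u' v'"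
  by (simp add: inner_on_def)

lemma inner_on_add_right: "inner_on S u (\<lambda>i. v i + of_real t * w i) = inner_on S u v + of_real t * inner_on S u w"
  by (simp add: inner_on_def algebra_simps sum.distrib sum_distrib_left)

lemma inner_on_add_left: "inner_on S (\<lambda>i. v i + of_real t * w i) u = inner_on S v u + of_real t * inner_on S w u"
  by (simp add: inner_on_def algebra_simps sum.distrib sum_distrib_left)

lemma fapply_add: "fapply S A (\<lambda>i. v i + of_real t * w i) = (\<lambda>i. fapply S A v i + of_real t * fapply S A w i)"
  by (simp add: fapply_def algebra_simps sum.distrib sum_distrib_left fun_eq_iff)

lemma inner_on_cnj: "cnj (inner_on S u v) = inner_on S v u"
  by (simp add: inner_on_def mult.commute)

lemma inner_on_fapply_adjoint: "fhermitian A \<Longrightarrow> inner_on S (fapply S A u) v = inner_on S u (fapply S A v)"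
proof -
  assume h: "fhermitian A"
  have "inner_on S (fapply S A u) v = (\<Sum>i\<in>S. \<Sum>j\<in>S. A j i * cnj (u j) * v i)"
    using h by (simp add: inner_on_def fapply_def sum_distrib_right fhermitian_def)
  also have "\<dots> = (\<Sum>j\<in>S. \<Sum>i\<in>S. A j i * cnj (u j) * v i)" by (rule sum.swap)
  also have "\<dots> = inner_on S u (fapply S A v)"
    by (simp add: inner_on_def fapply_def sum_distrib_left mult_ac)
  finally show ?thesis .
qed

lemma quad_form_add_scaled: "quad_form S (add_scaled t A B) v = quad_form S A v + t * quad_form S B v"
  by (simp add: quad_form_def fapply_add_scaled inner_on_add_right)

lemma inner_on_self: "inner_on S v v = of_real (\<Sum>i\<in>S. (cmod (v i))\<^sup>2)"
  unfolding inner_on_def of_real_sum complex_norm_square by (simp add: mult.commute)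

lemma quad_form_fident: "finite S \<Longrightarrow> quad_form S (fident S) v = (\<Sum>i\<in>S. (cmod (v i))\<^sup>2)"
proof -
  assume "finite S"
  then have "inner_on S v (fapply S (fident S) v) = inner_on S v v"
    by (intro inner_on_cong) (auto simp: fapply_fident)
  then show ?thesis by (simp add: quad_form_def inner_on_self del: of_real_sum)
qed

section \<open>Positivity and inverses\<close>

lemma pd_on_imp_psd_on: "pd_on S A \<Longrightarrow> psd_on S A"
  unfolding psd_on_def pd_on_def
proof
  fix v assume *: "\<forall>v. (\<exists>i\<in>S. v i \<noteq> 0) \<longrightarrow> 0 < quad_form S A v"
  show "0 \<le> quad_form S A v"
  proof (cases "\<exists>i\<in>S. v i \<noteq> 0")
    case True then show ?thesis using * by (simp add: less_imp_le)
  next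
    case False then show ?thesis by (simp add: quad_form_def inner_on_def)
  qed
qed

text \<open>On \<open>S\<close> one has v = C (M v), and \<open>C\<close> can be moved across the
  inner product.\<close>

lemma quad_form_inverse:
  assumes "finite S" "fhermitian C" "inverse_on S C M"
  shows "quad_form S M v = quad_form S C (fapply S M v)"
proof -
  have "inner_on S v (fapply S M v) = inner_on S (fapply S (fident S) v) (fapply S M v)"
    using assms by (intro inner_on_cong) (auto simp: fapply_fident)
  also have "fapply S (fident S) v = fapply S C (fapply S M v)"
    using assms(3) by (simp add: inverse_on_def flip: fapply_fmult)
  also have "inner_on S (fapply S C (fapply S M v)) (fapply S M v) = inner_on S (fapply S M v) (fapply S C (fapply S M v))"
    using assms by (simp add: inner_on_fapply_adjoint)
  finally show ?thesis by (simp add: quad_form_def)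
qed

text \<open>The form of \<open>M\<close> at v is the form of \<open>C\<close> at M v, and M v cannot
  vanish on \<open>S\<close> because \<open>C\<close> maps it back to v.\<close>

lemma pd_on_inverse:
  assumes "finite S" "fhermitian C" "inverse_on S C M" "pd_on S C"
  shows "pd_on S M"
  unfolding pd_on_def
proof (intro allI impI)
  fix v :: "nat \<Rightarrow> complex" assume v: "\<exists>i\<in>S. v i \<noteq> 0"
  have "\<exists>i\<in>S. fapply S M v i \<noteq> 0"
  proof (rule ccontr)
    assume "\<not> ?thesis"
    then have "fapply S C (fapply S M v) i = 0" for i unfolding fapply_def[of S C] by simp
    then have "fapply S (fident S) v i = 0" for i
      using assms(3) by (metis inverse_on_def fapply_fmult)
    then show False using v assms(1) by (metis fapply_fident)
  qed
  then show "0 < quad_form S M v" using quad_form_inverse[OF assms(1-3)] assms(4) by (simp add: pd_on_def)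
qed

text \<open>The adjoint of \<open>M\<close> is a left inverse of \<open>C\<close>, and a left
  inverse agrees with the right inverse \<open>M\<close>.\<close>

lemma fhermitian_inverse:
  assumes "finite S" "fhermitian C" "inverse_on S C M"
  shows "fhermitian M"
proof -
  define N where "N = (\<lambda>i j. cnj (M j i))"
  have sM: "supported S M" and CM: "fmult S C M = fident S" and MC: "fmult S M C = fident S"
    using assms(3) by (auto simp: inverse_on_def)
  have sN: "supported S N" using sM by (auto simp: supported_def N_def)
  have "fmult S N C i j = fident S i j" for i j
  proof -
    have "fmult S N C i j = cnj (fmult S C M j i)"
      using assms(2) by (simp add: fmult_def N_def fhermitian_def mult.commute)
    then show ?thesis using CM fhermitian_fident by (simp add: fhermitian_def)
  qed
  then have "fmult S N C = fident S" by blast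
  then have "N = M" using sM sN CM assms(1)
    by (metis fmult_assoc fmult_fident_left fmult_fident_right)
  then show ?thesis by (metis N_def fhermitian_def)
qed

section \<open>Trace inequalities\<close>

text \<open>Each diagonal entry of Y K Y is the form of \<open>K\<close> at a column of
  \<open>Y\<close>. This turns positivity of \<open>K\<close> into nonnegativity of traces.\<close>

lemma ftrace_sandwich:
  assumes "fhermitian Y"
  shows "ftrace S (fmult S Y (fmult S K Y)) = (\<Sum>i\<in>S. quad_form S K (\<lambda>k. Y k i))"
  using assms by (simp add: ftrace_def quad_form_def inner_on_def fapply_def fmult_def fhermitian_def)

lemma quad_form_basis:
  assumes "finite S" "i \<in> S"
  shows "quad_form S K (\<lambda>k. if k = i then 1 else 0) = Re (K i i)"
proof -
  have "fapply S K (\<lambda>k. if k = i then 1 else 0) = (\<lambda>j. K j i)"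
    using assms by (simp add: fapply_def if_distrib cong: if_cong)
  moreover have "inner_on S (\<lambda>k. if k = i then 1 else 0) w = w i" for w
  proof -
    have "inner_on S (\<lambda>k. if k = i then 1 else 0) w = (\<Sum>k\<in>S. if k = i then w i else 0)"
      unfolding inner_on_def by (intro sum.cong) auto
    then show ?thesis using assms by simp
  qed
  ultimately show ?thesis by (simp add: quad_form_def)
qed

lemma quadratic_nonneg_discriminant:
  fixes a p q :: real
  assumes "\<And>t. 0 \<le> q - 2 * t * p + t\<^sup>2 * a" "0 \<le> a"
  shows "p\<^sup>2 \<le> a * q"
proof (cases "a = 0")
  case True
  have "p = 0"
  proof (rule ccontr)
    assume "p \<noteq> 0"
    \<comment> \<open>At this t the expression equals -1.\<close>
    then show False using assms(1)[of "(q + 1) / (2 * p)"] True by (simp add: field_simps)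
  qed
  then show ?thesis using True by simp
next
  case False
  then show ?thesis using assms(1)[of "p / a"] assms(2)
    by (simp add: field_simps power2_eq_square)
qed

lemma ftrace_psd_on_nonneg: "finite S \<Longrightarrow> psd_on S K \<Longrightarrow> 0 \<le> ftrace S K"
  unfolding ftrace_def Re_sum
  by (intro sum_nonneg) (metis quad_form_basis psd_on_def)

text \<open>Cauchy-Schwarz for the semi-inner product tr (X K Y) of \<open>X\<close> and
  \<open>Y\<close>, applied to the identity and \<open>Y\<close>: the polynomial tr ((Y - t) K (Y -
  t)) in t is never negative.\<close>

lemma ftrace_cauchy_schwarz:
  assumes S: "finite S" and K: "psd_on S K" "supported S K" and Y: "fhermitian Y" "supported S Y"
  shows "(ftrace S (fmult S K Y))\<^sup>2 \<le> ftrace S K * ftrace S (fmult S Y (fmult S K Y))"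
proof (rule quadratic_nonneg_discriminant)
  fix t :: real
  define Z where "Z = add_scaled (-t) Y (fident S)"
  have "fhermitian Z" unfolding Z_def by (intro fhermitian_add_scaled Y fhermitian_fident)
  then have "0 \<le> ftrace S (fmult S Z (fmult S K Z))"
    using K by (simp add: ftrace_sandwich psd_on_def sum_nonneg)
  also have "\<dots> = ftrace S (fmult S Y (fmult S K Y)) - 2 * t * ftrace S (fmult S K Y) + t\<^sup>2 * ftrace S K"
  proof -
    have "supported S (fmult S K Y)" using K(2) Y(2) by (auto simp: supported_def fmult_def)
    then show ?thesis using S K Y ftrace_fmult_commute[of S Y K]
      by (simp add: Z_def fmult_add_scaled_left fmult_add_scaled_right ftrace_add_scaled
          fmult_fident_left fmult_fident_right power2_eq_square algebra_simps)
  qed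
  finally show "0 \<le> ftrace S (fmult S Y (fmult S K Y)) - 2 * t * ftrace S (fmult S K Y) + t\<^sup>2 * ftrace S K" .
qed (use ftrace_psd_on_nonneg assms in blast)

text \<open>The form of \<open>M\<close> is tested on a vector living on the two indices, with the
  conjugates of \<open>v j\<close> and \<open>- v i\<close> as entries. Summed over all pairs, this
  compares \<open>M\<close> with its trace.\<close>

lemma psd_on_two_entries:
  assumes S: "finite S" and M: "psd_on S M" "fhermitian M" and ij: "i \<in> S" "j \<in> S"
  shows "2 * Re (cnj (v i) * M i j * v j) \<le> (cmod (v j))\<^sup>2 * Re (M i i) + (cmod (v i))\<^sup>2 * Re (M j j)"
proof -
  \<comment> \<open>Adding the two contributions makes \<open>w\<close> vanish when
    \<open>i = j\<close>, so that case needs no separate treatment.\<close>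
  define w where "w = (\<lambda>k. (if k = i then cnj (v j) else 0) + (if k = j then - cnj (v i) else 0))"
  have a: "fapply S M w = (\<lambda>k. M k i * cnj (v j) - M k j * cnj (v i))"
  proof
    fix k
    have "fapply S M w k = (\<Sum>l\<in>S. (if l = i then M k i * cnj (v j) else 0)
        + (if l = j then - M k j * cnj (v i) else 0))"
      unfolding fapply_def w_def by (intro sum.cong) (auto simp: algebra_simps)
    then show "fapply S M w k = M k i * cnj (v j) - M k j * cnj (v i)" using S ij by (simp add: sum.distrib)
  qed
  have b: "inner_on S w u = v j * u i - v i * u j" for u
  proof -
    have "inner_on S w u = (\<Sum>k\<in>S. (if k = i then v j * u i else 0) + (if k = j then - v i * u j else 0))"
      unfolding inner_on_def w_def by (intro sum.cong) (auto simp: algebra_simps)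
    then show ?thesis using S ij by (simp add: sum.distrib)
  qed
  have c: "Re (cnj (v j) * M j i * v i) = Re (cnj (v i) * M i j * v j)"
  proof -
    have "cnj (v j) * M j i * v i = cnj (cnj (v i) * M i j * v j)"
      using M(2) by (simp add: fhermitian_def mult_ac)
    then show ?thesis by (simp only: cnj.sel)
  qed
  have "0 \<le> quad_form S M w" using M by (simp add: psd_on_def)
  also have "quad_form S M w = Re (v j * cnj (v j) * M i i + v i * cnj (v i) * M j j
      - cnj (v i) * M i j * v j - cnj (v j) * M j i * v i)"
    unfolding quad_form_def a b by (simp add: algebra_simps)
  also have "\<dots> = (cmod (v j))\<^sup>2 * Re (M i i) + (cmod (v i))\<^sup>2 * Re (M j j)
      - 2 * Re (cnj (v i) * M i j * v j)"
  proof -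
    have "v k * cnj (v k) * z = of_real ((cmod (v k))\<^sup>2) * z" for k z
      by (simp only: complex_norm_square)
    then show ?thesis using c by (simp only: minus_complex.sel plus_complex.sel
          Re_complex_of_real Im_complex_of_real times_complex.sel) simp
  qed
  finally show ?thesis by simp
qed

text \<open>The trace dominates the largest eigenvalue of a positive kernel; summing the pairwise
  inequality proves this without diagonalization.\<close>

lemma quad_form_le_ftrace:
  assumes S: "finite S" and M: "psd_on S M" "fhermitian M"
  shows "quad_form S M v \<le> ftrace S M * quad_form S (fident S) v"
proof -
  have q: "2 * quad_form S M v = (\<Sum>i\<in>S. \<Sum>j\<in>S. 2 * Re (cnj (v i) * M i j * v j))"
    by (simp add: quad_form_def inner_on_def fapply_def sum_distrib_left mult.assoc del: times_complex.sel)
  also have "\<dots> \<le> (\<Sum>i\<in>S. \<Sum>j\<in>S. (cmod (v j))\<^sup>2 * Re (M i i) + (cmod (v i))\<^sup>2 * Re (M j j))"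
    using assms by (intro sum_mono psd_on_two_entries) auto
  also have "\<dots> = 2 * (ftrace S M * quad_form S (fident S) v)"
    by (simp add: sum.distrib quad_form_fident S ftrace_def sum_product mult.commute)
      (subst sum.swap, simp add: mult.commute)
  finally show ?thesis by simp
qed

section \<open>One step: raising the barrier and deleting an index\<close>

text \<open>Positivity of \<open>C\<close> at u = v - e M v reads 0 \<le> (v, C v) - 2 e (v, v) +
  e^2 (v, M v). Since (v, M v) \<le> tr M (v, v) and e tr M < 1, the last term is below e (v, v) for
  v nonzero on \<open>S\<close>, which leaves (v, C v) > e (v, v).\<close>

lemma pd_on_shift:
  assumes S: "finite S" and C: "fhermitian C" "pd_on S C" and M: "inverse_on S C M"
    and e: "0 < e" "e * ftrace S M < 1"
  shows "pd_on S (add_scaled (-e) C (fident S))"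
  unfolding pd_on_def
proof (intro allI impI)
  fix v :: "nat \<Rightarrow> complex" assume v: "\<exists>i\<in>S. v i \<noteq> 0"
  let ?N = "quad_form S (fident S) v"
  have N: "0 < ?N"
    using v S unfolding quad_form_fident[OF S] by (auto intro!: sum_pos2)
  have hM: "fhermitian M" and pM: "pd_on S M" using fhermitian_inverse pd_on_inverse assms by blast+
  have CM: "fmult S C M = fident S" using M by (simp add: inverse_on_def)
  define u where "u = (\<lambda>i. v i + of_real (- e) * fapply S M v i)"
  have Cu: "fapply S C u = (\<lambda>i. fapply S C v i + of_real (- e) * fapply S (fident S) v i)"
    unfolding u_def fapply_add by (simp add: CM flip: fapply_fmult)
  have x: "inner_on S (fapply S M v) (fapply S C v) = inner_on S v (fapply S (fident S) v)"
    unfolding inner_on_fapply_adjoint[OF hM] using M by (simp add: inverse_on_def flip: fapply_fmult)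
  have y: "Re (inner_on S (fapply S M v) (fapply S (fident S) v)) = quad_form S M v"
    unfolding inner_on_fapply_adjoint[OF hM] quad_form_def using S M
    by (simp add: inverse_on_def fmult_fident_right flip: fapply_fmult)
  have "0 \<le> quad_form S C u" using C(2) pd_on_imp_psd_on by (auto simp: psd_on_def)
  also have "\<dots> = quad_form S C v - 2 * e * ?N + e\<^sup>2 * quad_form S M v"
    using y unfolding quad_form_def Cu by (subst (1) u_def)
      (simp add: inner_on_add_left inner_on_add_right x algebra_simps power2_eq_square del: of_real_minus)
  also have "\<dots> \<le> quad_form S C v - 2 * e * ?N + e\<^sup>2 * (ftrace S M * ?N)"
    using quad_form_le_ftrace[OF S pd_on_imp_psd_on[OF pM] hM] by (simp add: mult_left_mono)
  also have "e\<^sup>2 * (ftrace S M * ?N) = (e * ftrace S M) * (e * ?N)" by (simp add: power2_eq_square)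
  also have "\<dots> < 1 * (e * ?N)" using e N by (intro mult_strict_right_mono) auto
  finally show "0 < quad_form S (add_scaled (-e) C (fident S)) v" by (simp add: quad_form_add_scaled)
qed

lemma supported_fmult: "supported S A \<Longrightarrow> supported S B \<Longrightarrow> supported S (fmult S A B)"
  unfolding supported_def fmult_def by (auto intro!: sum.neutral)

lemma supported_eqI:
  "supported S A \<Longrightarrow> supported S B \<Longrightarrow> (\<And>i j. i \<in> S \<Longrightarrow> j \<in> S \<Longrightarrow> A i j = B i j) \<Longrightarrow> A = B"
  unfolding supported_def by (intro ext) metis

text \<open>With \<open>a = tr M\<close>, \<open>p = tr (M F)\<close>, \<open>q = tr (F M F)\<close> and the resolvent identity
  \<open>F = M + e M F\<close>, one has \<open>tr F = a + e p\<close> and \<open>tr F\<^sup>2 = p + e q\<close>, while \<open>p\<^sup>2 \<le> a q\<close>, \<open>0 \<le> p\<close> and \<open>e a < 1\<close>. Hence the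
  average of the ratios \<open>(F\<^sup>2)\<^sub>i\<^sub>i / F\<^sub>i\<^sub>i\<close> with weights \<open>F\<^sub>i\<^sub>i\<close> is at least \<open>tr F - tr M\<close>.\<close>

lemma deletion_index:
  assumes S: "finite S" "S \<noteq> {}" and C: "fhermitian C" "pd_on S C" and M: "inverse_on S C M"
    and F: "inverse_on S (add_scaled (-e) C (fident S)) F" and D: "pd_on S (add_scaled (-e) C (fident S))"
    and e: "0 < e" "e * ftrace S M < 1"
  shows "\<exists>i\<in>S. 0 < Re (F i i) \<and> ftrace S F - Re (fmult S F F i i) / Re (F i i) \<le> ftrace S M"
proof -
  have hD: "fhermitian (add_scaled (-e) C (fident S))" by (intro fhermitian_add_scaled C fhermitian_fident)
  have hM: "fhermitian M" and pM: "psd_on S M" and hF: "fhermitian F" and pF: "pd_on S F"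
    using fhermitian_inverse pd_on_inverse pd_on_imp_psd_on S C M F D hD by blast+
  have sM: "supported S M" and MC: "fmult S M C = fident S" and CM: "fmult S C M = fident S"
    using M by (auto simp: inverse_on_def)
  have sF: "supported S F" and DF: "fmult S (add_scaled (-e) C (fident S)) F = fident S"
    and FD: "fmult S F (add_scaled (-e) C (fident S)) = fident S"
    using F by (auto simp: inverse_on_def)
  have "fmult S C F = add_scaled e (fident S) F"
    using DF unfolding fmult_add_scaled_left fmult_fident_left[OF S(1) sF]
    by (auto simp: add_scaled_def fun_eq_iff algebra_simps)
  then have FMF: "F = add_scaled e M (fmult S M F)"
    using MC S sM sF by (metis fmult_assoc fmult_add_scaled_right fmult_fident_left fmult_fident_right)
  \<comment> \<open>The mirrored resolvent identity F = M + e F M is needed for the sign of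
    \<open>p\<close>.\<close>
  have "fmult S F C = add_scaled e (fident S) F"
    using FD unfolding fmult_add_scaled_right fmult_fident_right[OF S(1) sF]
    by (auto simp: add_scaled_def fun_eq_iff algebra_simps)
  then have FFM: "F = add_scaled e M (fmult S F M)"
    using CM S sM sF by (metis fmult_assoc fmult_add_scaled_left fmult_fident_left fmult_fident_right)
  define a p q where "a = ftrace S M" and "p = ftrace S (fmult S M F)" and "q = ftrace S (fmult S F (fmult S M F))"
  have trF: "ftrace S F = a + e * p"
    by (subst FMF) (simp add: ftrace_add_scaled a_def p_def)
  have "fmult S F F = add_scaled e (fmult S F M) (fmult S F (fmult S M F))"
    by (subst (2) FMF) (simp add: fmult_add_scaled_right)
  then have trFF: "ftrace S (fmult S F F) = p + e * q"
    by (simp add: ftrace_add_scaled p_def q_def ftrace_fmult_commute)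
  have a: "0 \<le> a" unfolding a_def by (rule ftrace_psd_on_nonneg[OF S(1) pM])
  have pq: "p\<^sup>2 \<le> a * q"
    unfolding p_def q_def a_def by (rule ftrace_cauchy_schwarz) fact+
  have q: "0 \<le> q" unfolding q_def using ftrace_sandwich[OF hF] pM by (simp add: psd_on_def sum_nonneg)
  have p: "0 \<le> p"
  proof -
    \<comment> \<open>Substituting the mirrored identity splits tr (M F) into tr (M I M) and e tr (M
      F M), both sandwiches of positive kernels.\<close>
    have "fmult S M F = add_scaled e (fmult S M M) (fmult S M (fmult S F M))"
      by (subst FFM) (simp add: fmult_add_scaled_right)
    then have "p = ftrace S (fmult S M (fmult S (fident S) M)) + e * ftrace S (fmult S M (fmult S F M))"
      by (simp add: p_def ftrace_add_scaled fmult_fident_left[OF S(1) sM])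
    moreover have "psd_on S (fident S)" by (simp add: psd_on_def quad_form_fident S sum_nonneg)
    ultimately show ?thesis
      using ftrace_sandwich[OF hM] pd_on_imp_psd_on[OF pF] e by (simp add: psd_on_def sum_nonneg)
  qed
  \<comment> \<open>By \<open>trF\<close> and \<open>trFF\<close> this says (tr F - tr M) tr F \<le>
    tr (F F).\<close>
  have key: "e * p * (a + e * p) \<le> p + e * q"
  proof -
    have ea: "e * a \<le> 1" using e by (simp add: a_def)
    have "(e * a) * p \<le> 1 * p" using ea p by (rule mult_right_mono)
    moreover have "e\<^sup>2 * p\<^sup>2 \<le> e\<^sup>2 * (a * q)" using pq by (rule mult_left_mono) simp
    moreover have "(e * a) * (e * q) \<le> 1 * (e * q)" using ea e q by (intro mult_right_mono) auto
    ultimately show ?thesis by (simp add: algebra_simps power2_eq_square)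
  qed
  have Fii: "0 < Re (F i i)" if "i \<in> S" for i
  proof -
    have "0 < quad_form S F (\<lambda>k. if k = i then 1 else 0)"
      using that by (intro pF[unfolded pd_on_def, rule_format]) auto
    then show ?thesis using quad_form_basis[OF S(1) that] by simp
  qed
  show ?thesis
  proof (rule ccontr)
    assume "\<not> ?thesis"
    then have neg: "a < ftrace S F - Re (fmult S F F i i) / Re (F i i)" if "i \<in> S" for i
      using Fii that by (force simp: a_def)
    have "Re (fmult S F F i i) < e * p * Re (F i i)" if "i \<in> S" for i
      using neg[OF that] Fii[OF that] by (simp add: trF field_simps)
    then have "ftrace S (fmult S F F) < e * p * ftrace S F"
      unfolding ftrace_def Re_sum sum_distrib_left using S by (intro sum_strict_mono) auto
    then show False using key by (simp add: trF trFF)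
  qed
qed

text \<open>The new inverse vanishes on row and column \<open>a\<close>, so sums over \<open>S - {a}\<close> may be taken over \<open>S\<close>.\<close>

lemma inverse_on_delete:
  assumes S: "finite S" "a \<in> S" and F: "inverse_on S D F" and a: "F a a \<noteq> 0"
  shows "inverse_on (S - {a}) (\<lambda>i j. if i \<in> S - {a} \<and> j \<in> S - {a} then D i j else 0)
           (\<lambda>i j. F i j - F i a * F a j / F a a)"
    (is "inverse_on ?T ?D ?G")
proof -
  have sF: "supported S F" and DF: "fmult S D F = fident S" and FD: "fmult S F D = fident S"
    using F by (auto simp: inverse_on_def)
  have sG: "supported ?T ?G" using sF a by (auto simp: supported_def)
  have left: "fmult ?T ?G ?D i j = fident ?T i j" if "i \<in> ?T" "j \<in> ?T" for i j
  proof -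
    have "fmult ?T ?G ?D i j = (\<Sum>k\<in>?T. ?G i k * D k j)"
      using that unfolding fmult_def by (intro sum.cong) auto
    also have "\<dots> = (\<Sum>k\<in>S. ?G i k * D k j)"
      using S a by (simp add: sum.remove[of S a])
    \<comment> \<open>The second term contains the entry (a, j) of the identity, which is zero
      because \<open>j\<close> differs from \<open>a\<close>. The other product is treated
      symmetrically.\<close>
    also have "\<dots> = fmult S F D i j - F i a / F a a * fmult S F D a j"
      unfolding fmult_def by (simp add: algebra_simps sum_subtractf sum_distrib_left)
    finally show ?thesis using that by (auto simp: FD fident_def)
  qed
  have right: "fmult ?T ?D ?G i j = fident ?T i j" if "i \<in> ?T" "j \<in> ?T" for i j
  proof -
    have "fmult ?T ?D ?G i j = (\<Sum>k\<in>?T. D i k * ?G k j)"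
      using that unfolding fmult_def by (intro sum.cong) auto
    also have "\<dots> = (\<Sum>k\<in>S. D i k * ?G k j)"
      using S a by (simp add: sum.remove[of S a])
    also have "\<dots> = fmult S D F i j - fmult S D F i a * (F a j / F a a)"
      unfolding fmult_def sum_distrib_right by (simp add: algebra_simps sum_subtractf)
    finally show ?thesis using that by (auto simp: DF fident_def)
  qed
  have "supported ?T ?D" by (auto simp: supported_def)
  then have "supported ?T (fmult ?T ?G ?D)" "supported ?T (fmult ?T ?D ?G)"
    using sG supported_fmult by blast+
  then have "fmult ?T ?G ?D = fident ?T" "fmult ?T ?D ?G = fident ?T"
    using left right supported_fident supported_eqI by blast+
  then show ?thesis using sG by (simp add: inverse_on_def)
qed

text \<open>The diagonal entry at \<open>a\<close> of the updated inverse is zero, so the trace may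
  be taken over all of \<open>S\<close>; the rank-one corrections then sum to the diagonal entry of
  F F divided by \<open>F a a\<close>. This is the quantity controlled by
  \<open>deletion_index\<close>.\<close>

lemma ftrace_delete:
  assumes S: "finite S" "a \<in> S" and F: "F a a \<noteq> 0" "Im (F a a) = 0"
  shows "ftrace (S - {a}) (\<lambda>i j. F i j - F i a * F a j / F a a) = ftrace S F - Re (fmult S F F a a) / Re (F a a)"
proof -
  have "(\<Sum>i\<in>S - {a}. F i i - F i a * F a i / F a a) = (\<Sum>i\<in>S. F i i - F i a * F a i / F a a)"
    using S F by (simp add: sum.remove[of S a])
  also have "\<dots> = (\<Sum>i\<in>S. F i i) - fmult S F F a a / F a a"
    by (simp add: sum_subtractf fmult_def sum_divide_distrib mult.commute)
  finally have *: "(\<Sum>i\<in>S - {a}. F i i - F i a * F a i / F a a) = (\<Sum>i\<in>S. F i i) - fmult S F F a a / F a a" .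
  have "F a a = of_real (Re (F a a))" using F(2) by (simp add: complex_eq_iff)
  then have "Re (fmult S F F a a / F a a) = Re (fmult S F F a a) / Re (F a a)"
    by (metis Re_divide_of_real)
  then show ?thesis unfolding ftrace_def * by simp
qed

section \<open>Shifted principal submatrices\<close>

text \<open>Encodes A_S - x I. Truncating \<open>A\<close> as well lets one kernel \<open>A\<close>
  serve every index set met during the deletions.\<close>

definition shifted :: "nat set \<Rightarrow> kernel \<Rightarrow> real \<Rightarrow> kernel" where
  "shifted S A x = (\<lambda>i j. if i \<in> S \<and> j \<in> S then A i j - (if i = j then of_real x else 0) else 0)"

lemma shifted_add: "shifted S A (x + e) = add_scaled (-e) (shifted S A x) (fident S)"
  by (auto simp: shifted_def add_scaled_def fident_def fun_eq_iff)

text \<open>Brings the shift on a smaller set into the shape produced by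
  \<open>inverse_on_delete\<close>.\<close>

lemma shifted_mono: "T \<subseteq> S \<Longrightarrow>
    shifted T A x = (\<lambda>i j. if i \<in> T \<and> j \<in> T then shifted S A x i j else 0)"
  by (auto simp: shifted_def fun_eq_iff)

lemma supported_shifted: "supported S (shifted S A x)"
  by (auto simp: supported_def shifted_def)

lemma fhermitian_shifted: "fhermitian A \<Longrightarrow> fhermitian (shifted S A x)"
  by (auto simp: fhermitian_def shifted_def)

lemma quad_form_shifted: "finite S \<Longrightarrow> quad_form S (shifted S A x) v = quad_form S A v - x * quad_form S (fident S) v"
proof -
  have "quad_form S (shifted S A x) v = quad_form S (add_scaled (-x) A (fident S)) v"
    unfolding quad_form_def by (intro arg_cong[where f = Re] inner_on_cong)
      (auto simp: fapply_def shifted_def add_scaled_def fident_def intro!: sum.cong)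
  then show ?thesis by (simp add: quad_form_add_scaled)
qed

lemma quad_form_restrict:
  assumes "finite S" "T \<subseteq> S"
  shows "quad_form T A v = quad_form S A (\<lambda>i. if i \<in> T then v i else 0)"
proof -
  let ?w = "\<lambda>i. if i \<in> T then v i else 0"
  have a: "fapply S A ?w = fapply T A v"
    unfolding fapply_def using assms by (intro ext sum.mono_neutral_cong_right) auto
  have "inner_on S ?w u = inner_on T v u" for u
    unfolding inner_on_def using assms by (intro sum.mono_neutral_cong_right) auto
  then show ?thesis by (simp add: quad_form_def a)
qed

lemma pd_on_shifted_subset:
  assumes S: "finite S" "T \<subseteq> S" and pd_on: "pd_on S (shifted S A x)"
  shows "pd_on T (shifted T A x)"
  unfolding pd_on_def
proof (intro allI impI)
  fix v :: "nat \<Rightarrow> complex" assume v: "\<exists>i\<in>T. v i \<noteq> 0"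
  let ?w = "\<lambda>i. if i \<in> T then v i else 0"
  have T: "finite T" using S finite_subset by blast
  have "0 < quad_form S (shifted S A x) ?w"
    using v S(2) by (intro pd_on[unfolded pd_on_def, rule_format]) auto
  also have "\<dots> = quad_form T (shifted S A x) v" using quad_form_restrict[OF S] by metis
  also have "\<dots> = quad_form T (shifted T A x) v"
    unfolding quad_form_def using S(2) by (intro arg_cong[where f = Re] inner_on_cong)
      (auto simp: fapply_def shifted_def intro!: sum.cong)
  finally show "0 < quad_form T (shifted T A x) v" .
qed

section \<open>Existence of inverses by renumbering\<close>

text \<open>The bridge from kernels to genuine matrices, used both for determinants and for
  eigenvectors.\<close>

lemma fapply_reindex:
  assumes p: "bij_betw p {0..<N} S" and v: "v \<in> carrier_vec N"
    and w: "\<And>b. b < N \<Longrightarrow> w (p b) = v $ b" and a: "a < N"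
    and B: "B \<in> carrier_mat N N" "\<And>a b. a < N \<Longrightarrow> b < N \<Longrightarrow> B $$ (a, b) = C (p a) (p b)"
  shows "fapply S C w (p a) = (B *\<^sub>v v) $ a"
proof -
  have "fapply S C w (p a) = (\<Sum>b\<in>{0..<N}. C (p a) (p b) * w (p b))"
    unfolding fapply_def by (rule sum.reindex_bij_betw[OF p, symmetric])
  also have "\<dots> = (\<Sum>b\<in>{0..<N}. B $$ (a, b) * v $ b)"
    using a B w by (intro sum.cong) auto
  finally show ?thesis using a B v by (simp add: scalar_prod_def)
qed

text \<open>After renumbering \<open>S\<close>, a null vector of the matrix would be a vector with
  zero quadratic form. Hence the determinant is nonzero, and the matrix inverse is carried back to
  \<open>S\<close>.\<close>

lemma inverse_on_exists:
  assumes S: "finite S" and C: "supported S C" "pd_on S C"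
  shows "\<exists>M. inverse_on S C M"
proof -
  define N where "N = card S"
  obtain p where p: "bij_betw p {0..<N} S"
    using ex_bij_betw_nat_finite[OF S] by (auto simp: N_def)
  define q where "q = inv_into {0..<N} p"
  have qp: "q (p a) = a" if "a < N" for a
    using p that by (simp add: q_def bij_betw_def inv_into_f_f)
  have pq: "p (q i) = i" "q i < N" if "i \<in> S" for i
    using p that bij_betw_inv_into_right[OF p that] inv_into_into[of i p "{0..<N}"]
    by (auto simp: q_def bij_betw_def)
  have pS: "p a \<in> S" if "a < N" for a using p that by (auto simp: bij_betw_def)
  define B where "B = mat N N (\<lambda>(a, b). C (p a) (p b))"
  have B: "B \<in> carrier_mat N N" and Bi: "\<And>a b. a < N \<Longrightarrow> b < N \<Longrightarrow> B $$ (a, b) = C (p a) (p b)"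
    by (auto simp: B_def)
  have "det B \<noteq> 0"
  proof
    assume "det B = 0"
    then obtain v where v: "v \<in> carrier_vec N" "v \<noteq> 0\<^sub>v N" "B *\<^sub>v v = 0\<^sub>v N"
      using det_0_iff_vec_prod_zero[OF B] by blast
    obtain b where b: "b < N" "v $ b \<noteq> 0" using v(1,2) by (metis carrier_vecD eq_vecI index_zero_vec)
    let ?w = "\<lambda>i. v $ q i"
    have "fapply S C ?w (p a) = 0" if "a < N" for a
      using fapply_reindex[OF p v(1), of ?w a B C] that qp v B Bi by simp
    then have "fapply S C ?w i = 0" if "i \<in> S" for i using pq that by metis
    then have "quad_form S C ?w = 0" by (simp add: quad_form_def inner_on_def)
    moreover have "\<exists>i\<in>S. ?w i \<noteq> 0" using b pS qp by metis
    ultimately show False using C(2) by (metis pd_on_def less_irrefl)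
  qed
  then have "B \<in> Units (ring_mat TYPE(complex) N ())" by (rule det_non_zero_imp_unit[OF B])
  then obtain B' where B': "B' \<in> carrier_mat N N" "B' * B = 1\<^sub>m N" "B * B' = 1\<^sub>m N"
    by (auto simp: Units_def ring_mat_def)
  define M where "M = (\<lambda>i j. if i \<in> S \<and> j \<in> S then B' $$ (q i, q j) else 0)"
  have sM: "supported S M" by (auto simp: supported_def M_def)
  have "fmult S M C i j = fident S i j" if "i \<in> S" "j \<in> S" for i j
  proof -
    have "fmult S M C i j = (\<Sum>b\<in>{0..<N}. M i (p b) * C (p b) j)"
      unfolding fmult_def by (rule sum.reindex_bij_betw[OF p, symmetric])
    also have "\<dots> = (\<Sum>b\<in>{0..<N}. B' $$ (q i, b) * B $$ (b, q j))"
      using that by (intro sum.cong) (auto simp: M_def pS qp Bi pq)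
    also have "\<dots> = (B' * B) $$ (q i, q j)"
      using B B'(1) that pq by (simp add: scalar_prod_def)
    also have "\<dots> = fident S i j"
      unfolding B' using that pq by (auto simp: fident_def) (metis pq(1))
    finally show ?thesis .
  qed
  moreover have "fmult S C M i j = fident S i j" if "i \<in> S" "j \<in> S" for i j
  proof -
    have "fmult S C M i j = (\<Sum>b\<in>{0..<N}. C i (p b) * M (p b) j)"
      unfolding fmult_def by (rule sum.reindex_bij_betw[OF p, symmetric])
    also have "\<dots> = (\<Sum>b\<in>{0..<N}. B $$ (q i, b) * B' $$ (b, q j))"
      using that by (intro sum.cong) (auto simp: M_def pS qp Bi pq)
    also have "\<dots> = (B * B') $$ (q i, q j)"
      using B B'(1) that pq by (simp add: scalar_prod_def)
    also have "\<dots> = fident S i j"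
      unfolding B' using that pq by (auto simp: fident_def) (metis pq(1))
    finally show ?thesis .
  qed
  moreover have "supported S (fmult S M C)" "supported S (fmult S C M)"
    using sM C(1) supported_fmult by blast+
  ultimately have "fmult S M C = fident S" "fmult S C M = fident S"
    using supported_fident supported_eqI by blast+
  then show ?thesis using sM by (auto simp: inverse_on_def)
qed

section \<open>Iterating the deletions\<close>

text \<open>The resolvent trace never increases, so the same step \<open>e\<close> stays admissible:
  after each deletion the smaller set, the raised level and the updated inverse satisfy the
  hypotheses again.\<close>

lemma greedy_deletion:
  assumes "finite S" "fhermitian A" "pd_on S (shifted S A x)" "inverse_on S (shifted S A x) M"
    and "0 < e" "e * ftrace S M < 1" "k \<le> card S"
  shows "\<exists>T\<subseteq>S. card T = card S - k \<and> pd_on T (shifted T A (x + real k * e))"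
  using assms
proof (induction k arbitrary: S x M)
  case 0
  then show ?case by auto
next
  case (Suc k)
  have S: "finite S" "S \<noteq> {}" using Suc.prems by auto
  note hA = Suc.prems(2)
  let ?D = "shifted S A (x + e)"
  \<comment> \<open>The barrier is raised on all of \<open>S\<close> before an index is chosen;
    positivity at the new level then passes to the subset.\<close>
  have D: "pd_on S ?D" unfolding shifted_add
    by (rule pd_on_shift) (use Suc.prems fhermitian_shifted in auto)
  obtain F where F: "inverse_on S ?D F"
    using inverse_on_exists[OF S(1) supported_shifted D] by blast
  obtain a where a: "a \<in> S" "0 < Re (F a a)" "ftrace S F - Re (fmult S F F a a) / Re (F a a) \<le> ftrace S M"
    using deletion_index[OF S fhermitian_shifted[OF hA] Suc.prems(3,4) F[unfolded shifted_add]
        D[unfolded shifted_add] Suc.prems(5,6)] by blast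
  let ?T = "S - {a}" and ?G = "\<lambda>i j. F i j - F i a * F a j / F a a"
  have Fa: "F a a \<noteq> 0" using a(2) by auto
  have "fhermitian F" by (rule fhermitian_inverse[OF S(1) fhermitian_shifted[OF hA] F])
  then have Im: "Im (F a a) = 0" by (metis fhermitian_def cnj.sel(2) equal_neg_zero)
  have G: "inverse_on ?T (shifted ?T A (x + e)) ?G"
    using inverse_on_delete[OF S(1) a(1) F Fa] shifted_mono[of ?T S] by auto
  have "ftrace ?T ?G \<le> ftrace S M" using a(3) ftrace_delete[where S = S and F = F, OF S(1) a(1) Fa Im] by simp
  then have "e * ftrace ?T ?G < 1"
    using Suc.prems(5,6) by (meson le_less_trans mult_left_mono less_imp_le)
  moreover have "pd_on ?T (shifted ?T A (x + e))" by (rule pd_on_shifted_subset[OF S(1) _ D]) auto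
  moreover have "k \<le> card ?T" using Suc.prems(7) a(1) S by simp
  ultimately obtain T where "T \<subseteq> ?T" "card T = card ?T - k" "pd_on T (shifted T A (x + e + real k * e))"
    using Suc.IH[of ?T "x + e" ?G] S hA G Suc.prems(5) by auto
  then show ?case using a(1) S by (intro exI[of _ T]) (auto simp: algebra_simps)
qed

section \<open>The resolvent trace at the starting level\<close>

text \<open>Cauchy-Schwarz for K = A (A + s)^-1 and Y = A + s: here K Y = A, K = I - s M and Y K Y =
  A A + s A.\<close>

lemma ftrace_resolvent_bound:
  assumes S: "finite S" and A: "fhermitian A" "supported S A" "psd_on S A" and s: "0 < s"
    and M: "inverse_on S (add_scaled s A (fident S)) M"
  shows "(ftrace S A)\<^sup>2 \<le> (card S - s * ftrace S M) * (ftrace S (fmult S A A) + s * ftrace S A)"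
proof -
  let ?C = "add_scaled s A (fident S)"
  define K where "K = fmult S A M"
  have hC: "fhermitian ?C" and sC: "supported S ?C"
    using A supported_fident fhermitian_fident supported_add_scaled fhermitian_add_scaled by auto
  have sM: "supported S M" and CM: "fmult S ?C M = fident S" and MC: "fmult S M ?C = fident S"
    using M by (auto simp: inverse_on_def)
  have sK: "supported S K" using A(2) sM by (auto simp: K_def supported_def fmult_def)
  have K: "K = add_scaled (-s) (fident S) M"
    using CM unfolding fmult_add_scaled_left fmult_fident_left[OF S sM] K_def
    by (auto simp: add_scaled_def fun_eq_iff algebra_simps)
  have KC: "fmult S K ?C = A"
    unfolding K_def fmult_assoc MC by (rule fmult_fident_right[OF S A(2)])
  \<comment> \<open>With u = M v one has v = (A + s) u and K v = A u, so the form at v is |A u|^2 +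
    s (u, A u).\<close>
  have "psd_on S K" unfolding psd_on_def
  proof
    fix v
    define u where "u = fapply S M v"
    have "inner_on S v (fapply S K v) = inner_on S (fapply S (fident S) v) (fapply S A u)"
      unfolding K_def fapply_fmult u_def using S by (intro inner_on_cong) (auto simp: fapply_fident)
    also have "fapply S (fident S) v = fapply S ?C u"
      using fapply_fmult[of S ?C M v] by (simp only: CM u_def)
    also have "inner_on S \<dots> (fapply S A u) = inner_on S (fapply S A u) (fapply S A u) + of_real s * inner_on S u (fapply S A u)"
      unfolding fapply_add_scaled inner_on_add_left using S
      by (intro arg_cong2[where f = "(+)"] arg_cong2[where f = "(*)"] inner_on_cong) (auto simp: fapply_fident)
    finally have "quad_form S K v = (\<Sum>i\<in>S. (cmod (fapply S A u i))\<^sup>2) + s * quad_form S A u"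
      by (simp add: quad_form_def inner_on_self del: of_real_sum)
    then show "0 \<le> quad_form S K v" using A(3) s by (simp add: psd_on_def sum_nonneg)
  qed
  from ftrace_cauchy_schwarz[OF S this sK hC sC]
  have "(ftrace S A)\<^sup>2 \<le> ftrace S K * ftrace S (fmult S ?C A)" by (simp add: KC)
  then show ?thesis
    by (simp add: K ftrace_add_scaled ftrace_fident S fmult_add_scaled_left fmult_fident_left A(2))
qed

section \<open>Removing the loss and choosing the shift\<close>

text \<open>If every member of \<open>F\<close> failed, each would fail with some positive slack at
  a fixed \<open>v\<close>; the least of these finitely many slacks contradicts
  \<open>approx\<close>.\<close>

lemma exists_attaining_limit:
  fixes T :: real and N Q :: "'a \<Rightarrow> 'b \<Rightarrow> real"
  assumes F: "finite F" and N: "\<And>S v. 0 \<le> N S v"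
    and approx: "\<And>\<eta>. 0 < \<eta> \<Longrightarrow> \<exists>S\<in>F. \<forall>v. (T - \<eta>) * N S v \<le> Q S v"
  shows "\<exists>S\<in>F. \<forall>v. T * N S v \<le> Q S v"
proof (rule ccontr)
  assume "\<not> ?thesis"
  then have "\<exists>v. Q S v < T * N S v" if "S \<in> F" for S using that by (meson not_le)
  then obtain v where v: "Q S (v S) < T * N S (v S)" if "S \<in> F" for S by metis
  have "\<exists>\<eta>>0. Q S (v S) < (T - \<eta>) * N S (v S)" if S: "S \<in> F" for S
  proof -
    \<comment> \<open>Half of the gap, spread over 1 + N; the summand 1 keeps the denominator
      positive when N vanishes.\<close>
    let ?d = "(T * N S (v S) - Q S (v S)) / (2 * (1 + N S (v S)))"
    have pos: "0 < 1 + N S (v S)" using N[of S "v S"] by linarith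
    have d: "0 < ?d" using v[OF S] pos by simp
    have "?d * N S (v S) \<le> ?d * (1 + N S (v S))" using d by (intro mult_left_mono) auto
    also have "\<dots> = (T * N S (v S) - Q S (v S)) / 2"
    proof -
      have "x / (2 * P) * P = x / 2" if "0 < P" for x P :: real using that by simp
      then show ?thesis using pos by blast
    qed
    also have "\<dots> < T * N S (v S) - Q S (v S)" using v[OF S] by simp
    finally show ?thesis using d by (intro exI[of _ ?d]) (simp only: left_diff_distrib, simp)
  qed
  then obtain \<eta> where \<eta>: "0 < \<eta> S" "Q S (v S) < (T - \<eta> S) * N S (v S)" if "S \<in> F" for S by metis
  have "F \<noteq> {}" using approx[of 1] by auto
  then have "0 < Min (\<eta> ` F)" using F \<eta>(1) by simp
  then obtain S where S: "S \<in> F" "\<forall>v. (T - Min (\<eta> ` F)) * N S v \<le> Q S v" using approx by blast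
  have "Min (\<eta> ` F) \<le> \<eta> S" using F S(1) by simp
  then have "(T - \<eta> S) * N S (v S) \<le> (T - Min (\<eta> ` F)) * N S (v S)"
    using N by (intro mult_right_mono) auto
  then show False using S(2) \<eta>(2)[OF S(1)] by (meson leD order_trans)
qed

text \<open>The witness is the maximiser of the right-hand side over \<open>s \<ge> 0\<close>, except that for
  \<open>\<delta> = c\<close> it degenerates to \<open>s = 0\<close> and is only approached.\<close>

lemma exists_good_shift:
  fixes \<tau> \<rho> c \<delta> \<eta> :: real
  assumes pos: "0 < \<tau>" "0 < c" "c \<le> \<delta>" "\<delta> < 1" "0 < \<eta>" and \<rho>: "\<rho> = \<tau>\<^sup>2 * \<delta> / c"
  shows "\<exists>s>0. \<tau> * (sqrt (1 - c) - sqrt (\<delta> - c))\<^sup>2 - \<eta>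
      < (1 - c) * (s * (\<rho> + s * \<tau>) / (\<rho> + s * \<tau> - \<tau>\<^sup>2)) - s"
proof (cases "\<delta> = c")
  case True
  \<comment> \<open>Here the quotient collapses to \<tau> + s, so the right-hand side is \<tau> (1 -
    c) - c s and falls short by only c \<eta> / 2.\<close>
  let ?s = "\<eta> / 2"
  have "\<rho> = \<tau>\<^sup>2" using \<rho> True pos by simp
  then have "?s * (\<rho> + ?s * \<tau>) / (\<rho> + ?s * \<tau> - \<tau>\<^sup>2) = \<tau> + ?s"
    using pos by (simp add: power2_eq_square field_simps)
  moreover have "\<tau> * (1 - c) - \<eta> < (1 - c) * (\<tau> + ?s) - ?s"
  proof -
    have "\<eta> * c < \<eta> * 1" using pos True by (intro mult_strict_left_mono) auto
    then show ?thesis using pos by (simp add: field_simps)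
  qed
  moreover have "(sqrt (1 - c) - sqrt (\<delta> - c))\<^sup>2 = 1 - c" using True pos by simp
  ultimately show ?thesis using pos by (intro exI[of _ ?s]) simp
next
  case False
  define \<sigma> \<omega> where "\<sigma> = sqrt (1 - c)" and "\<omega> = sqrt (\<delta> - c)"
  have \<sigma>2: "\<sigma>\<^sup>2 = 1 - c" and \<omega>2: "\<omega>\<^sup>2 = \<delta> - c" using pos by (auto simp: \<sigma>_def \<omega>_def)
  have \<omega>: "0 < \<omega>" and lt: "\<omega> < \<sigma>" using pos False by (auto simp: \<sigma>_def \<omega>_def)
  define s where "s = \<tau> * \<omega> * (\<sigma> - \<omega>) / c"
  have s: "0 < s" using pos \<omega> lt by (simp add: s_def)
  have "\<rho> + s * \<tau> = \<tau>\<^sup>2 * (c + \<omega>\<^sup>2 + \<omega> * (\<sigma> - \<omega>)) / c"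
    unfolding \<rho> s_def \<omega>2 using pos by (simp add: field_simps power2_eq_square)
  then have r: "\<rho> + s * \<tau> = \<tau>\<^sup>2 * (c + \<omega> * \<sigma>) / c" by (simp add: algebra_simps power2_eq_square)
  then have r': "\<rho> + s * \<tau> - \<tau>\<^sup>2 = \<tau>\<^sup>2 * (\<omega> * \<sigma>) / c" using pos by (simp add: field_simps)
  \<comment> \<open>At this s the factor \<tau>^2 / c cancels from the quotient, and 1 - \<sigma>^2
    = c makes \<sigma> - \<omega> a factor of the rest.\<close>
  have "(1 - c) * (s * (\<rho> + s * \<tau>) / (\<rho> + s * \<tau> - \<tau>\<^sup>2)) - s
      = \<sigma>\<^sup>2 * (s * (c + \<omega> * \<sigma>) / (\<omega> * \<sigma>)) - s"
    unfolding r' r \<sigma>2 using pos \<omega> lt by (simp add: field_simps)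
  also have "\<dots> = s * (\<sigma> * c - \<omega> * (1 - \<sigma>\<^sup>2)) / \<omega>"
    using \<omega> lt by (simp add: field_simps power2_eq_square)
  also have "1 - \<sigma>\<^sup>2 = c" using \<sigma>2 by simp
  also have "s * (\<sigma> * c - \<omega> * c) / \<omega> = \<tau> * (\<sigma> - \<omega>)\<^sup>2"
    using \<omega> pos by (simp add: s_def field_simps power2_eq_square)
  finally show ?thesis using s pos unfolding \<sigma>_def \<omega>_def by (intro exI[of _ s]) simp
qed

section \<open>The bound in terms of quadratic forms\<close>

lemma principal_submatrix_bound:
  fixes \<tau> \<rho> c \<delta> :: real
  assumes S: "finite S" "card S = n" "0 < n"
    and A: "fhermitian A" "supported S A" "psd_on S A"
    and ftrace: "ftrace S A = n * \<tau>" "ftrace S (fmult S A A) = n * \<rho>"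
    and pos: "0 < \<tau>" "0 < c" "c \<le> \<delta>" "\<delta> \<le> 1" and \<rho>: "\<rho> = \<tau>\<^sup>2 * \<delta> / c"
    and m: "real m = c * n" "m \<le> n"
  shows "\<exists>T\<subseteq>S. card T = m \<and> (\<forall>v. \<tau> * (sqrt (1 - c) - sqrt (\<delta> - c))\<^sup>2 * quad_form T (fident T) v \<le> quad_form T A v)"
proof (cases "\<delta> = 1")
  case True
  \<comment> \<open>For \<delta> = 1 the two square roots coincide and the target is 0, so any
    subset of size \<open>m\<close> works by positivity.\<close>
  obtain T where T: "T \<subseteq> S" "card T = m" "finite T"
    using obtain_subset_with_card_n[of m S] m S by auto
  then show ?thesis using True A(3) quad_form_restrict[OF S(1) T(1), of A]
    by (intro exI[of _ T]) (simp add: psd_on_def)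
next
  case False
  let ?t = "\<tau> * (sqrt (1 - c) - sqrt (\<delta> - c))\<^sup>2"
  let ?F = "{T. T \<subseteq> S \<and> card T = m}"
  have "\<exists>T\<in>?F. \<forall>v. ?t * quad_form T (fident T) v \<le> quad_form T A v"
  proof (rule exists_attaining_limit)
    show "finite ?F" using S by simp
    show "0 \<le> quad_form T (fident T) v" for T v
    proof (cases "finite T")
      case True
      then show ?thesis by (simp add: quad_form_fident sum_nonneg)
    qed (simp add: quad_form_def inner_on_def)
    fix \<eta> :: real assume \<eta>: "0 < \<eta>"
    obtain s where s: "0 < s"
      and gs: "?t - \<eta> < (1 - c) * (s * (\<rho> + s * \<tau>) / (\<rho> + s * \<tau> - \<tau>\<^sup>2)) - s"
      using exists_good_shift[of \<tau> c \<delta> \<eta> \<rho>] pos False \<eta> \<rho> by auto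
    \<comment> \<open>\<open>ftrace_resolvent_bound\<close> will rearrange to R tr M \<le> n. This
      makes R / n the critical step size.\<close>
    define R where "R = s * (\<rho> + s * \<tau>) / (\<rho> + s * \<tau> - \<tau>\<^sup>2)"
    have "\<tau>\<^sup>2 * 1 \<le> \<tau>\<^sup>2 * (\<delta> / c)" using pos by (intro mult_left_mono) auto
    then have \<rho>\<tau>: "\<tau>\<^sup>2 \<le> \<rho>" using \<rho> by simp
    have st: "0 < s * \<tau>" using s pos by simp
    have den: "0 < \<rho> + s * \<tau> - \<tau>\<^sup>2" using \<rho>\<tau> st by linarith
    have num: "0 < \<rho> + s * \<tau>" using den zero_le_power2[of \<tau>] by linarith
    have R: "0 < R" using s num den by (simp add: R_def)
    \<comment> \<open>The critical step would only give e tr M \<le> 1. The inequality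
      \<open>gs\<close> is strict, so R can be replaced by a slightly smaller y, which makes the
      step admissible.\<close>
    have "((?t - \<eta>) + s) < (1 - c) * R" using gs by (simp add: R_def)
    moreover have "((\<lambda>y. (1 - c) * y) \<longlongrightarrow> (1 - c) * R) (at_left R)" by (intro tendsto_intros)
    ultimately have "eventually (\<lambda>y. (?t - \<eta>) + s < (1 - c) * y) (at_left R)"
      by (rule order_tendstoD(1)[rotated])
    moreover have "eventually (\<lambda>y. y \<in> {0<..<R}) (at_left R)"
      using R eventually_at_left_real by blast
    ultimately have "eventually (\<lambda>y. ?t - \<eta> + s < (1 - c) * y \<and> y \<in> {0<..<R}) (at_left R)"
      by eventually_elim auto
    then obtain y where y: "?t - \<eta> + s < (1 - c) * y" "0 < y" "y < R"
      using eventually_happens[of _ "at_left R"] by auto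
    define e where "e = y / n"
    have e: "0 < e" using y S by (simp add: e_def)
    have eq: "add_scaled s A (fident S) = shifted S A (- s)"
      using A(2) by (auto simp: add_scaled_def fident_def shifted_def supported_def fun_eq_iff)
    have pd_on: "pd_on S (shifted S A (- s))"
      unfolding eq[symmetric] pd_on_def quad_form_add_scaled quad_form_fident[OF S(1)]
    proof (intro allI impI)
      fix v :: "nat \<Rightarrow> complex" assume "\<exists>i\<in>S. v i \<noteq> 0"
      then have "0 < (\<Sum>i\<in>S. (cmod (v i))\<^sup>2)" using S by (auto intro!: sum_pos2)
      then show "0 < quad_form S A v + s * (\<Sum>i\<in>S. (cmod (v i))\<^sup>2)"
        using A(3) s by (simp add: psd_on_def add_nonneg_pos)
    qed
    obtain M where M: "inverse_on S (shifted S A (- s)) M"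
      using inverse_on_exists[OF S(1) supported_shifted pd_on] by blast
    have "(n * \<tau>)\<^sup>2 \<le> (n - s * ftrace S M) * (n * \<rho> + s * (n * \<tau>))"
      using ftrace_resolvent_bound[OF S(1) A s M[folded eq]] S(2) by (simp add: ftrace)
    then have "n * (s * ftrace S M * (\<rho> + s * \<tau>)) \<le> n * (n * (\<rho> + s * \<tau> - \<tau>\<^sup>2))"
      by (simp add: algebra_simps power2_eq_square)
    then have "ftrace S M * (s * (\<rho> + s * \<tau>)) \<le> n * (\<rho> + s * \<tau> - \<tau>\<^sup>2)"
      using S(3) by (simp add: mult_ac)
    then have RM: "R * ftrace S M \<le> n" using den by (simp add: R_def field_simps)
    have "y * ftrace S M < n"
    proof (cases "0 < ftrace S M")
      case True
      then show ?thesis using y RM by (meson less_le_trans mult_strict_right_mono)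
    next
      case False
      then have "y * ftrace S M \<le> 0" using y by (simp add: mult_nonneg_nonpos)
      then show ?thesis using S(3) by linarith
    qed
    then have eM: "e * ftrace S M < 1" using S(3) by (simp add: e_def)
    obtain T where T: "T \<subseteq> S" "card T = card S - (n - m)"
      "pd_on T (shifted T A (- s + real (n - m) * e))"
      using greedy_deletion[OF S(1) A(1) pd_on M e eM, of "n - m"] S(2) by auto
    have fT: "finite T" using T(1) S(1) finite_subset by blast
    \<comment> \<open>Since m = c n, the n - m deletions move the barrier by (1 - c) n steps of
      length y / n.\<close>
    have "real (n - m) * e = (1 - c) * y"
      using m S(3) by (simp add: of_nat_diff e_def field_simps)
    then have lt: "?t - \<eta> \<le> - s + real (n - m) * e" using y by simp
    have "(?t - \<eta>) * quad_form T (fident T) v \<le> quad_form T A v" for v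
    proof -
      have "(?t - \<eta>) * quad_form T (fident T) v \<le> (- s + real (n - m) * e) * quad_form T (fident T) v"
        using lt by (rule mult_right_mono) (simp add: quad_form_fident fT sum_nonneg)
      also have "\<dots> \<le> quad_form T A v"
        using pd_on_imp_psd_on[OF T(3)] by (simp add: psd_on_def quad_form_shifted[OF fT])
      finally show ?thesis .
    qed
    then show "\<exists>T\<in>?F. \<forall>v. (?t - \<eta>) * quad_form T (fident T) v \<le> quad_form T A v"
      using T m(2) S(2) by (intro bexI[of _ T]) auto
  qed
  then show ?thesis by blast
qed

section \<open>From quadratic forms to eigenvalues of submatrices\<close>

lemma bij_betw_pick:
  assumes "finite S"
  shows "bij_betw (pick S) {0..<card S} S"
proof -
  have "inj_on (pick S) {0..<card S}"
    by (intro inj_onI) (metis atLeastLessThan_iff card_pick_le)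
  moreover have "pick S ` {0..<card S} \<subseteq> S" by (auto intro: pick_in_set_le)
  ultimately show ?thesis using assms
    by (simp add: bij_betw_def card_image card_subset_eq)
qed

text \<open>An eigenvector w for k satisfies (w, C w) = k (w, w). Hermitian symmetry makes k real,
  and the assumed bound makes it at least \<open>L\<close>.\<close>

lemma lambda_min_submatrix_ge:
  assumes A: "A \<in> carrier_mat n n" and S: "S \<subseteq> {0..<n}" "S \<noteq> {}"
    and C: "fhermitian C" "\<And>i j. i < n \<Longrightarrow> j < n \<Longrightarrow> C i j = A $$ (i, j)"
    and bound: "\<And>v. L * quad_form S (fident S) v \<le> quad_form S C v"
  shows "L \<le> lambda_min (submatrix A S S)"
proof -
  define N where "N = card S"
  define B where "B = submatrix A S S"
  have fS: "finite S" using S(1) finite_subset by blast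
  have "{i. i < n \<and> i \<in> S} = S" using S(1) by auto
  then have dims: "card {i. i < dim_row A \<and> i \<in> S} = N" "card {i. i < dim_col A \<and> i \<in> S} = N"
    using A by (simp_all add: N_def)
  have B: "B \<in> carrier_mat N N" unfolding B_def by (rule carrier_matI) (simp_all only: dim_submatrix dims)
  have p: "bij_betw (pick S) {0..<N} S" unfolding N_def by (rule bij_betw_pick[OF fS])
  have pS: "pick S a \<in> S" if "a < N" for a using p that by (auto simp: bij_betw_def)
  have Bi: "B $$ (a, b) = C (pick S a) (pick S b)" if "a < N" "b < N" for a b
  proof -
    have "B $$ (a, b) = A $$ (pick S a, pick S b)"
      unfolding B_def by (rule submatrix_index) (simp_all add: dims that)
    moreover have "pick S a < n" "pick S b < n" using pS that S(1) by force+
    ultimately show ?thesis by (simp add: C(2))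
  qed
  have ev: "Im k = 0 \<and> L \<le> Re k" if ev: "eigenvalue B k" for k
  proof -
    obtain v where v: "v \<in> carrier_vec N" "v \<noteq> 0\<^sub>v N" "B *\<^sub>v v = k \<cdot>\<^sub>v v"
      using ev B by (auto simp: eigenvalue_def eigenvector_def)
    \<comment> \<open>The eigenvector is indexed by positions in the submatrix; the inverse of
      \<open>pick S\<close> moves it to the original indices.\<close>
    define w where "w = (\<lambda>i. v $ inv_into {0..<N} (pick S) i)"
    have w: "w (pick S a) = v $ a" if "a < N" for a
      using p that by (simp add: w_def bij_betw_def inv_into_f_f)
    have "fapply S C w (pick S a) = k * w (pick S a)" if "a < N" for a
      using fapply_reindex[OF p v(1) w that B Bi] v that by (simp add: w)
    then have fapply: "fapply S C w i = k * w i" if "i \<in> S" for i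
      using p that by (force simp: bij_betw_def)
    have inner_on: "inner_on S w (fapply S C w) = k * of_real (quad_form S (fident S) w)"
    proof -
      have "inner_on S w (fapply S C w) = inner_on S w (\<lambda>i. k * w i)" by (intro inner_on_cong) (auto simp: fapply)
      also have "\<dots> = k * inner_on S w w" by (simp add: inner_on_def sum_distrib_left mult_ac)
      finally show ?thesis by (simp only: inner_on_self quad_form_fident[OF fS])
    qed
    obtain a where a: "a < N" "v $ a \<noteq> 0" using v(1,2) by (metis carrier_vecD eq_vecI index_zero_vec)
    then have pos: "0 < quad_form S (fident S) w"
      using pS w fS unfolding quad_form_fident[OF fS] by (intro sum_pos2[of S "pick S a"]) auto
    have "cnj (inner_on S w (fapply S C w)) = inner_on S w (fapply S C w)"
      by (simp add: inner_on_cnj inner_on_fapply_adjoint[OF C(1)])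
    then have "Im (inner_on S w (fapply S C w)) = 0" by (metis cnj.sel(2) equal_neg_zero)
    then have "Im k = 0" using inner_on pos by simp
    moreover have "L * quad_form S (fident S) w \<le> Re k * quad_form S (fident S) w"
      using bound[of w] by (simp add: quad_form_def[of S C] inner_on)
    ultimately show ?thesis using pos by simp
  qed
  let ?E = "{x. eigenvalue B (complex_of_real x)}"
  have "finite (spectrum B)" by (rule card_finite_spectrum[OF B])
  moreover have "?E \<subseteq> Re ` spectrum B" by (force simp: spectrum_def)
  ultimately have fin: "finite ?E" by (meson finite_imageI finite_subset)
  \<comment> \<open>A complex matrix of positive size has an eigenvalue, so the \<open>Min\<close>
    is not taken over the empty set, where it would be unspecified.\<close>
  have "N > 0" using S(2) fS by (simp add: N_def card_gt_0_iff)
  then obtain k where k: "eigenvalue B k"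
    using spectrum_non_empty[OF B] by (auto simp: spectrum_def)
  then have "k = of_real (Re k)" using ev by (simp add: complex_eq_iff)
  then have "Re k \<in> ?E" using k by simp
  then show ?thesis
    using fin unfolding lambda_min_def B_def[symmetric] by (intro Min.boundedI) (auto dest: ev)
qed

lemma hermitian_mat_index:
  assumes "A \<in> carrier_mat n n" "hermitian_mat A" "i < n" "j < n"
  shows "cnj (A $$ (i, j)) = A $$ (j, i)"
proof -
  have "mat_adjoint A $$ (j, i) = cnj (A $$ (i, j))"
    using assms by (simp add: mat_adjoint_def mat_of_rows_def conjugate_vec_def)
  then show ?thesis using assms(2) by (simp add: hermitian_mat_def)
qed

theorem theorem1p9:
  fixes A :: "complex mat" and n :: nat and \<delta> c :: real
  assumes "A \<in> carrier_mat n n"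
    and "A \<noteq> 0\<^sub>m n n"
    and "positive_contraction A"
    and "0 \<le> \<delta>" and "\<delta> \<le> 1"
    and "c = \<delta> * ((Re (ntr A))\<^sup>2 / Re (ntr (A * A)))"
    and "c * real n \<in> \<int>" and "0 < c * real n"
  shows "\<exists>S \<subseteq> {0..<n}. real (card S) = c * real n \<and>
           lambda_min (principal_submatrix A S) \<ge> Re (ntr A) * (sqrt (1 - c) - sqrt (\<delta> - c))\<^sup>2"
proof -
  let ?S = "{0..<n}"
  define C where "C = (\<lambda>i j. if i < n \<and> j < n then A $$ (i, j) else 0)"
  define \<tau> \<rho> where "\<tau> = Re (ntr A)" and "\<rho> = Re (ntr (A * A))"
  note A = assms(1)
  have hA: "hermitian_mat A" and psdA: "psd_mat (A - 0\<^sub>m n n)"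
    using assms(3) A by (auto simp: positive_contraction_def loewner_le_def)
  have C: "fhermitian C" "supported ?S C"
    using hermitian_mat_index[OF A hA] by (auto simp: fhermitian_def supported_def C_def)
  have psdC: "psd_on ?S C"
    unfolding psd_on_def
  proof
    fix v :: "nat \<Rightarrow> complex"
    define u where "u = vec n v"
    have u: "u \<in> carrier_vec n" by (simp add: u_def)
    have "A - 0\<^sub>m n n = A" using A by auto
    then have "0 \<le> Re ((A *\<^sub>v u) \<bullet>c u)" using psdA u A by (auto simp: psd_mat_def)
    also have "(A *\<^sub>v u) \<bullet>c u = (\<Sum>i\<in>?S. (A *\<^sub>v u) $ i * cnj (v i))"
      using A by (simp add: scalar_prod_def u_def)
    also have "\<dots> = inner_on ?S v (fapply ?S C v)"
      unfolding inner_on_def fapply_def using A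
      by (intro sum.cong refl) (auto simp: scalar_prod_def u_def C_def mult.commute intro!: sum.cong)
    finally show "0 \<le> quad_form ?S C v" by (simp add: quad_form_def)
  qed
  have n: "0 < n" using assms(8) by (cases n) auto
  have c: "0 < c" using assms(8) n by (simp add: zero_less_mult_iff)
  have trA: "ftrace ?S C = n * \<tau>"
    using A n by (simp add: ftrace_def C_def \<tau>_def ntr_def atLeast0LessThan Re_divide_of_nat)
  have trAA: "ftrace ?S (fmult ?S C C) = n * \<rho>"
    using A n by (simp add: ftrace_def fmult_def C_def \<rho>_def ntr_def scalar_prod_def atLeast0LessThan
        Re_divide_of_nat)
  \<comment> \<open>Cauchy-Schwarz with the identity as weight; this is what gives c \<le>
    \<delta>.\<close>
  have "(n * \<tau>)\<^sup>2 \<le> n * (n * \<rho>)"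
  proof -
    have "psd_on ?S (fident ?S)" by (simp add: psd_on_def quad_form_fident sum_nonneg)
    from ftrace_cauchy_schwarz[OF _ this supported_fident C(1,2)]
    show ?thesis by (simp add: fmult_fident_left C trA trAA ftrace_fident)
  qed
  then have \<tau>\<rho>: "\<tau>\<^sup>2 \<le> \<rho>" using n by (simp add: power2_eq_square)
  have cc: "c = \<delta> * (\<tau>\<^sup>2 / \<rho>)" using assms(6) by (simp add: \<tau>_def \<rho>_def)
  \<comment> \<open>Division by zero yields 0, so \<rho> = 0 would also force c = 0.\<close>
  have "\<tau> \<noteq> 0" "\<rho> \<noteq> 0" "\<delta> \<noteq> 0" using cc c by auto
  moreover have "0 \<le> \<tau>" using ftrace_psd_on_nonneg[OF _ psdC] trA n by (simp add: zero_le_mult_iff)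
  moreover have "0 \<le> \<rho>" using \<tau>\<rho> zero_le_power2 order_trans by blast
  ultimately have \<tau>: "0 < \<tau>" and \<rho>: "0 < \<rho>" and \<delta>: "0 < \<delta>" using assms(4) by auto
  have \<rho>eq: "\<rho> = \<tau>\<^sup>2 * \<delta> / c"
  proof -
    have "\<rho> * c = \<tau>\<^sup>2 * \<delta>" unfolding cc using \<rho> by simp
    then show ?thesis using c by (metis nonzero_mult_div_cancel_right less_irrefl)
  qed
  have "c \<le> \<delta> * 1" unfolding cc using \<tau>\<rho> \<rho> \<delta> by (intro mult_left_mono) auto
  then have c\<delta>: "c \<le> \<delta>" by simp
  obtain z where z: "c * real n = of_int z" using assms(7) by (auto elim: Ints_cases)
  define m where "m = nat z"
  have m: "real m = c * n" using z assms(8) by (simp add: m_def)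
  have "c * real n \<le> 1 * real n" using c\<delta> assms(5) by (intro mult_right_mono) auto
  then have mn: "m \<le> n" using m by linarith
  obtain T where T: "T \<subseteq> ?S" "card T = m"
    "\<forall>v. \<tau> * (sqrt (1 - c) - sqrt (\<delta> - c))\<^sup>2 * quad_form T (fident T) v \<le> quad_form T C v"
    using principal_submatrix_bound[OF _ _ n C psdC trA trAA \<tau> c c\<delta> assms(5) \<rho>eq m mn] by auto
  \<comment> \<open>The set has \<open>m\<close> elements and \<open>m\<close> is positive, so
    \<open>lambda_min\<close> is meaningful for the submatrix.\<close>
  have "T \<noteq> {}" using T(2) m assms(8) by auto
  then have "\<tau> * (sqrt (1 - c) - sqrt (\<delta> - c))\<^sup>2 \<le> lambda_min (submatrix A T T)"
    using T(3) by (intro lambda_min_submatrix_ge[OF A T(1) _ C(1)]) (auto simp: C_def)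
  then show ?thesis using T(1,2) m by (intro exI[of _ T]) (simp add: \<tau>_def)
qed

end
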